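(* Let $d\ge 1$ and $N\ge 1$ be integers. Let $\pi(\mathbf{x})=\gamma(\mathbf{x})/Z$ be a probability density on $\mathbb{R}^d$ with respect to Lebesgue measure, where $\gamma(\mathbf{x})=\exp\{-\phi(\mathbf{x})\}$ for a continuously differentiable function $\phi:\mathbb{R}^d\to\mathbb{R}$ and $Z=\int_{\mathbb{R}^d}\gamma(\mathbf{x})\,\mathrm{d}\mathbf{x}\in(0,\infty)$. Let $q$ be a probability density on $\mathbb{R}^d$ of the form $q(\mathbf{x})\propto\exp\{-\delta(\mathbf{x})\}$ with $\delta:\mathbb{R}^d\to\mathbb{R}$ differentiable, whose support covers that of $\pi$. Let $\mathbf{x}_{1:N}=(\mathbf{x}_1,\dots,\mathbf{x}_N)$ be distributed according to the extended target $\pi^N$ on $(\mathbb{R}^d)^N$, given by the density $$\pi^N(\mathbf{x}_{1:N})=\frac1N\sum_{i=1}^N\pi(\mathbf{x}_i)\prod_{j\neq i}q(\mathbf{x}_j).$$ Then, weighting each $\mathbf{x}_i$ with self-normalized weights proportional to $\gamma(\mathbf{x}_i)/q(\mathbf{x}_i)$, $i=1,\dots,N$, gives samples from $\pi$ in the sense that, for every $\pi$-integrable function $f:\mathbb{R}^d\to\mathbb{R}$, $$\mathbb{E}_{\pi^N}\!\left[\frac{\sum_{i=1}^N f(\mathbf{x}_i)\,\gamma(\mathbf{x}_i)/q(\mathbf{x}_i)}{\sum_{i=1}^N\gamma(\mathbf{x}_i)/q(\mathbf{x}_i)}\right]=\mathbb{E}_{\pi}[f(\mathbf{x})].$$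
   Context: $\mathbb{E}_{\pi}$ denotes expectation when $\mathbf{x}$ has density $\pi$ on $\mathbb{R}^d$, and $\mathbb{E}_{\pi^N}$ denotes expectation when $\mathbf{x}_{1:N}$ has density $\pi^N$ on $(\mathbb{R}^d)^N$. Equivalently, the extended target can be written $$\pi^N(\mathbf{x}_{1:N})=\frac1Z\left\{\frac1N\sum_{i=1}^N\frac{\gamma(\mathbf{x}_i)}{q(\mathbf{x}_i)}\right\}\prod_{i=1}^N q(\mathbf{x}_i).$$ An empty product is $1$, so for $N=1$ one has $\pi^N=\pi$. The density $q$ is called the instrumental distribution. A function $f$ is $\pi$-integrable if it is measurable and $\int_{\mathbb{R}^d}|f(\mathbf{x})|\,\pi(\mathbf{x})\,\mathrm{d}\mathbf{x}<\infty$. *)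

theory Defs
  imports "HOL-Analysis.Analysis"
begin

text \<open>The Frechet derivative exists everywhere and depends continuously on the base point, in
  operator norm. The library notion \<open>C1_differentiable_on\<close> only covers functions of one
  real variable.\<close>

definition continuously_differentiable ::
    "('a::real_normed_vector \<Rightarrow> 'b::real_normed_vector) \<Rightarrow> bool" where
  "continuously_differentiable f \<longleftrightarrow>
     (\<exists>f' :: 'a \<Rightarrow> 'a \<Rightarrow>\<^sub>L 'b.
        (\<forall>x. (f has_derivative blinfun_apply (f' x)) (at x)) \<and> continuous_on UNIV f')"

definition probability_density :: "'a measure \<Rightarrow> ('a \<Rightarrow> real) \<Rightarrow> bool" where
  "probability_density M p \<longleftrightarrow>
     p \<in> borel_measurable M \<and> (\<forall>x\<in>space M. 0 \<le> p x) \<and> (\<integral>\<^sup>+x. ennreal (p x) \<partial>M) = 1"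

definition density_support :: "('a::topological_space \<Rightarrow> real) \<Rightarrow> 'a set" where
  "density_support p = closure {x. p x \<noteq> 0}"

text \<open>The measure with density \<open>p\<close> with respect to \<open>M\<close>; expectations under \<open>p\<close> are Bochner
  integrals against it.\<close>

definition law :: "'a measure \<Rightarrow> ('a \<Rightarrow> real) \<Rightarrow> 'a measure" where
  "law M p = density M (\<lambda>x. ennreal (p x))"

text \<open>Lebesgue measure on \<open>N\<close>-tuples of points. A tuple is a function that is arbitrary on
  \<open>{1..N}\<close> and \<open>undefined\<close> elsewhere. The completion admits Lebesgue (not only Borel)
  measurable integrands, in line with \<^const>\<open>lebesgue\<close> on a single factor.\<close>

definition lebesgue_tuples :: "nat \<Rightarrow> (nat \<Rightarrow> 'a::euclidean_space) measure" where
  "lebesgue_tuples N = completion (\<Pi>\<^sub>M i\<in>{1..N}. lborel)"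

definition extended_target ::
    "nat \<Rightarrow> ('a \<Rightarrow> real) \<Rightarrow> ('a \<Rightarrow> real) \<Rightarrow> (nat \<Rightarrow> 'a) \<Rightarrow> real" where
  "extended_target N p q xs =
     1 / real N * (\<Sum>i=1..N. p (xs i) * (\<Prod>j\<in>{1..N} - {i}. q (xs j)))"

definition self_normalized_estimate ::
    "nat \<Rightarrow> ('a \<Rightarrow> real) \<Rightarrow> ('a \<Rightarrow> real) \<Rightarrow> ('a \<Rightarrow> real) \<Rightarrow> (nat \<Rightarrow> 'a) \<Rightarrow> real" where
  "self_normalized_estimate N g q f xs =
     (\<Sum>i=1..N. f (xs i) * (g (xs i) / q (xs i))) / (\<Sum>i=1..N. g (xs i) / q (xs i))"

end

theory Submission
  imports Defs
begin

text \<open>With \<open>w = \<gamma>/q\<close> the extended target is \<open>(\<Sum>i. w(x\<^sub>i)) * (\<Prod>j. q(x\<^sub>j)) / (N*Z)\<close>, whose first factor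
  cancels the denominator of the self-normalised estimate. What remains is the average over \<open>i\<close> of
  \<open>f(x\<^sub>i) * \<pi>(x\<^sub>i) * (\<Prod>j \<noteq> i. q(x\<^sub>j))\<close>, and by Fubini each of these terms integrates to the
  expectation of \<open>f\<close> under \<open>\<pi>\<close>.\<close>

text \<open>The preimage is a box with side \<open>A\<close> in direction \<open>i\<close> and full
  sides elsewhere. Its measure is a product with one factor 0, which vanishes even when other sides
  have infinite measure, as they do for \<open>lborel\<close>.\<close>

lemma (in product_sigma_finite) component_vimage_null_sets_PiM:
  assumes I: "finite I" "i \<in> I" and A: "A \<in> null_sets (M i)"
  shows "(\<lambda>x. x i) -` A \<inter> space (Pi\<^sub>M I M) \<in> null_sets (Pi\<^sub>M I M)"
proof -
  have A_sets: "A \<in> sets (M i)" using A by auto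
  let ?B = "\<lambda>j. if j = i then A else space (M j)"
  have eq: "(\<lambda>x. x i) -` A \<inter> space (Pi\<^sub>M I M) = Pi\<^sub>E I ?B"
    using I(2) sets.sets_into_space[OF A_sets] unfolding space_PiM PiE_iff vimage_def
    by (auto simp: PiE_iff Ball_def subset_iff split: if_splits)
  have "emeasure (Pi\<^sub>M I M) (Pi\<^sub>E I ?B) = (\<Prod>j\<in>I. emeasure (M j) (?B j))"
    using I A_sets by (intro emeasure_PiM) auto
  also have "\<dots> = 0"
    using I A by (intro prod_zero) (auto intro!: bexI[of _ i])
  finally show ?thesis
    using I A_sets by (auto simp: eq null_sets_def intro!: sets_PiM_I_finite)
qed

lemma (in product_sigma_finite) AE_component_PiM:
  assumes "finite I" "i \<in> I" and P: "AE y in M i. P y"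
  shows "AE x in Pi\<^sub>M I M. P (x i)"
proof -
  obtain A where A: "A \<in> null_sets (M i)" "{y \<in> space (M i). \<not> P y} \<subseteq> A"
    using P by (auto simp: eventually_ae_filter)
  show ?thesis
    using component_vimage_null_sets_PiM[OF assms(1,2) A(1)]
  proof (rule AE_I')
    show "{x \<in> space (Pi\<^sub>M I M). \<not> P (x i)} \<subseteq> (\<lambda>x. x i) -` A \<inter> space (Pi\<^sub>M I M)"
      using A(2) assms(2) by (auto simp: space_PiM dest: PiE_mem)
  qed
qed

text \<open>A set of \<open>completion (M i)\<close> is a set of \<open>M i\<close> up to a subset
  of a null set, so it suffices that coordinate maps pull null sets back to null sets. This is what
  makes Lebesgue measurable functions of one coordinate measurable on
  \<open>lebesgue_tuples\<close>.\<close>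

lemma (in product_sigma_finite) measurable_component_completion_PiM:
  assumes "finite I" "i \<in> I"
  shows "(\<lambda>x. x i) \<in> completion (Pi\<^sub>M I M) \<rightarrow>\<^sub>M completion (M i)"
proof (rule completion.measurable_completion2)
  show comp: "(\<lambda>x. x i) \<in> completion (Pi\<^sub>M I M) \<rightarrow>\<^sub>M M i"
    using assms(2) by (intro measurable_completion measurable_component_singleton)
  show "null_sets (M i) \<subseteq> null_sets (distr (completion (Pi\<^sub>M I M)) (M i) (\<lambda>x. x i))"
    using null_sets_completionI[OF component_vimage_null_sets_PiM[OF assms]]
    by (auto simp: null_sets_distr_iff[OF comp])
qed

text \<open>Fubini applies to factors measurable for \<open>M i\<close> itself. Each
  \<open>f i\<close> is therefore replaced by an \<open>M i\<close>-measurable version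
  \<open>g i\<close> equal to it almost everywhere, and the result is carried back along the almost
  everywhere equality of the two products.\<close>

lemma (in product_sigma_finite) has_bochner_integral_prod_completion_PiM:
  fixes f :: "'i \<Rightarrow> 'a \<Rightarrow> real"
  assumes I: "finite I" and f: "\<And>i. i \<in> I \<Longrightarrow> integrable (completion (M i)) (f i)"
  shows "has_bochner_integral (completion (Pi\<^sub>M I M)) (\<lambda>x. \<Prod>i\<in>I. f i (x i))
    (\<Prod>i\<in>I. integral\<^sup>L (completion (M i)) (f i))"
proof -
  have "\<exists>g. g \<in> borel_measurable (M i) \<and> (AE y in M i. f i y = g y)" if "i \<in> I" for i
    using completion_ex_borel_measurable_real[OF borel_measurable_integrable[OF f[OF that]]] by blast
  then obtain g where g: "\<And>i. i \<in> I \<Longrightarrow> g i \<in> borel_measurable (M i)"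
    and fg: "\<And>i. i \<in> I \<Longrightarrow> AE y in M i. f i y = g i y"
    by metis
  have g_integrable: "integrable (M i) (g i)"
    and g_integral: "integral\<^sup>L (M i) (g i) = integral\<^sup>L (completion (M i)) (f i)" if "i \<in> I" for i
  proof -
    have ae: "AE y in completion (M i). f i y = g i y"
      using fg[OF that] by (rule AE_completion)
    have "integrable (completion (M i)) (g i)"
      using integrable_cong_AE_imp[OF f[OF that] measurable_completion[OF g[OF that]]] ae
      by auto
    then show "integrable (M i) (g i)"
      using g[OF that] by (simp add: integrable_completion)
    have "integral\<^sup>L (completion (M i)) (f i) = integral\<^sup>L (completion (M i)) (g i)"
      using f[OF that] measurable_completion[OF g[OF that]] ae
      by (intro integral_cong_AE) auto
    then show "integral\<^sup>L (M i) (g i) = integral\<^sup>L (completion (M i)) (f i)"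
      using g[OF that] by (simp add: integral_completion)
  qed
  let ?F = "\<lambda>x. \<Prod>i\<in>I. f i (x i)" and ?G = "\<lambda>x. \<Prod>i\<in>I. g i (x i)"
  have G_integrable: "integrable (Pi\<^sub>M I M) ?G"
    using I g_integrable by (rule product_integrable_prod)
  then have G_meas: "?G \<in> borel_measurable (Pi\<^sub>M I M)"
    by auto
  have F_meas: "?F \<in> borel_measurable (completion (Pi\<^sub>M I M))"
    using I f by (intro borel_measurable_prod measurable_compose[OF measurable_component_completion_PiM]) auto
  \<comment> \<open>The exceptional set is a finite union of coordinate preimages of null
    sets.\<close>
  have "AE x in Pi\<^sub>M I M. \<forall>i\<in>I. f i (x i) = g i (x i)"
    using I fg by (intro AE_finite_allI AE_component_PiM) auto
  then have "AE x in completion (Pi\<^sub>M I M). ?F x = ?G x"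
    by (intro AE_completion) (auto elim!: eventually_mono intro!: prod.cong)
  moreover have "has_bochner_integral (completion (Pi\<^sub>M I M)) ?G
      (\<Prod>i\<in>I. integral\<^sup>L (completion (M i)) (f i))"
    using G_integrable product_integral_prod[OF I g_integrable]
    by (simp add: has_bochner_integral_iff integrable_completion[OF G_meas]
        integral_completion[OF G_meas] g_integral)
  ultimately show ?thesis
    using F_meas measurable_completion[OF G_meas] has_bochner_integral_cong_AE by blast
qed

lemma probability_density_has_bochner_integral:
  assumes "probability_density M p"
  shows "has_bochner_integral M p 1"
  using assms unfolding probability_density_def
  by (intro has_bochner_integral_nn_integral) auto

text \<open>The integrand is a product over all coordinates with \<open>g\<close> in slot
  \<open>i\<close> and \<open>q\<close> in the others, and each \<open>q\<close> integrates to
  1.\<close>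

lemma has_bochner_integral_swapped_component:
  fixes g q :: "'a::euclidean_space \<Rightarrow> real"
  assumes i: "i \<in> {1..N}" and g: "integrable lebesgue g"
    and q: "has_bochner_integral lebesgue q 1"
  shows "has_bochner_integral (lebesgue_tuples N)
    (\<lambda>xs. g (xs i) * (\<Prod>j\<in>{1..N} - {i}. q (xs j))) (integral\<^sup>L lebesgue g)"
proof -
  interpret product_sigma_finite "\<lambda>_ :: nat. lborel :: 'a measure" ..
  let ?h = "\<lambda>j. if j = i then g else q"
  have "has_bochner_integral (lebesgue_tuples N) (\<lambda>xs. \<Prod>j\<in>{1..N}. ?h j (xs j))
      (\<Prod>j\<in>{1..N}. integral\<^sup>L lebesgue (?h j))"
    unfolding lebesgue_tuples_def
    using g q by (intro has_bochner_integral_prod_completion_PiM) (auto simp: has_bochner_integral_iff)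
  moreover have "(\<Prod>j\<in>{1..N}. ?h j (xs j)) = g (xs i) * (\<Prod>j\<in>{1..N} - {i}. q (xs j))" for xs
    using i by (subst prod.remove[of _ i]) (auto intro!: prod.cong)
  moreover have "(\<Prod>j\<in>{1..N}. integral\<^sup>L lebesgue (?h j)) = integral\<^sup>L lebesgue g"
    using i q by (subst prod.remove[of _ i]) (auto simp: has_bochner_integral_iff intro!: prod.neutral)
  ultimately show ?thesis
    by simp
qed

lemma extended_target_mult_self_normalized_estimate:
  fixes p g q f :: "'a \<Rightarrow> real"
  assumes N: "N \<ge> 1" and g: "\<And>x. g x > 0" and q: "\<And>x. q x > 0" and p: "\<And>x. p x = g x / Z"
  shows "extended_target N p q xs * self_normalized_estimate N g q f xs =
    (\<Sum>i=1..N. f (xs i) * p (xs i) * (\<Prod>j\<in>{1..N} - {i}. q (xs j))) / real N"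
proof -
  let ?Q = "\<Prod>j\<in>{1..N}. q (xs j)"
  let ?W = "\<Sum>i=1..N. g (xs i) / q (xs i)"
  \<comment> \<open>Multiplying and dividing by \<open>q (xs i)\<close> completes the product to
    \<open>?Q\<close>, a factor common to all \<open>i\<close>.\<close>
  have term_eq: "p (xs i) * (\<Prod>j\<in>{1..N} - {i}. q (xs j)) = ?Q / Z * (g (xs i) / q (xs i))"
    if "i \<in> {1..N}" for i
  proof -
    have "?Q = q (xs i) * (\<Prod>j\<in>{1..N} - {i}. q (xs j))"
      using that by (intro prod.remove) auto
    then show ?thesis
      using q[of "xs i"] by (simp add: p)
  qed
  have "(\<Sum>i=1..N. p (xs i) * (\<Prod>j\<in>{1..N} - {i}. q (xs j))) = ?Q / Z * ?W"
    unfolding sum_distrib_left by (intro sum.cong refl term_eq)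
  then have "extended_target N p q xs = ?Q / Z * ?W / real N"
    by (simp add: extended_target_def)
  \<comment> \<open>The sum is nonempty because \<open>N\<close> is at least 1, so dividing by
    \<open>?W\<close> in the estimate is a true cancellation.\<close>
  moreover have "?W > 0"
    using N g q by (intro sum_pos) auto
  moreover have "(\<Sum>i=1..N. f (xs i) * p (xs i) * (\<Prod>j\<in>{1..N} - {i}. q (xs j))) =
      ?Q / Z * (\<Sum>i=1..N. f (xs i) * (g (xs i) / q (xs i)))"
    unfolding sum_distrib_left mult.assoc[of "f _"]
    by (intro sum.cong refl) (simp only: term_eq mult.left_commute)
  ultimately show ?thesis
    by (simp add: self_normalized_estimate_def)
qed

theorem theorem2p1:
  fixes \<phi> \<delta> \<gamma> \<pi> q f :: "real ^ 'd \<Rightarrow> real"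
    and Z :: real and N :: nat
  assumes "N \<ge> 1"
    and "continuously_differentiable \<phi>"
    and "\<And>x. \<gamma> x = exp (- \<phi> x)"
    and "integrable lebesgue \<gamma>"
    and "Z = (\<integral>x. \<gamma> x \<partial>lebesgue)"
    and "Z > 0"
    and "\<And>x. \<pi> x = \<gamma> x / Z"
    and "probability_density lebesgue \<pi>"
    and "\<And>x. \<delta> differentiable (at x)"
    and "\<exists>c>0. \<forall>x. q x = c * exp (- \<delta> x)"
    and "probability_density lebesgue q"
    and "density_support \<pi> \<subseteq> density_support q"
    and "f \<in> borel_measurable lebesgue"
    and "(\<integral>\<^sup>+x. ennreal (\<bar>f x\<bar> * \<pi> x) \<partial>lebesgue) < \<infinity>"
  shows "integrable (law (lebesgue_tuples N) (extended_target N \<pi> q))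
           (self_normalized_estimate N \<gamma> q f) \<and>
         (\<integral>xs. self_normalized_estimate N \<gamma> q f xs
            \<partial>law (lebesgue_tuples N) (extended_target N \<pi> q))
         = (\<integral>x. f x \<partial>law lebesgue \<pi>)"
proof -
  interpret product_sigma_finite "\<lambda>_ :: nat. lborel :: (real ^ 'd) measure" ..
  let ?C = "lebesgue_tuples N :: (nat \<Rightarrow> real ^ 'd) measure"
  let ?S = "self_normalized_estimate N \<gamma> q f" and ?T = "extended_target N \<pi> q"
  have \<gamma>_pos: "\<gamma> x > 0" for x
    using assms(3) by simp
  have q_pos: "q x > 0" for x
    using assms(10) by auto
  have \<pi>_nonneg: "\<pi> x \<ge> 0" for x
    using \<gamma>_pos[of x] assms(6,7) by simp
  have meas [measurable]: "\<pi> \<in> borel_measurable lebesgue" "q \<in> borel_measurable lebesgue"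
    "f \<in> borel_measurable lebesgue" "\<gamma> \<in> borel_measurable lebesgue"
    using assms(4,8,11,13) by (auto simp: probability_density_def)
  have f\<pi>: "integrable lebesgue (\<lambda>x. f x * \<pi> x)"
    using assms(14) \<pi>_nonneg by (intro integrableI_bounded) (auto simp: abs_mult)
  \<comment> \<open>Here \<open>h\<close> is only Lebesgue measurable, so the coordinate map has to
    be measurable between the completions.\<close>
  have comp: "(\<lambda>xs. h (xs i)) \<in> borel_measurable ?C"
    if "i \<in> {1..N}" "h \<in> borel_measurable lebesgue" for i and h :: "real ^ 'd \<Rightarrow> real"
    unfolding lebesgue_tuples_def using that
    by (intro measurable_compose[OF measurable_component_completion_PiM]) auto
  have S_meas: "?S \<in> borel_measurable ?C"
    unfolding self_normalized_estimate_def [abs_def]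
    by (intro borel_measurable_divide borel_measurable_sum borel_measurable_times comp meas)
  have T_meas: "?T \<in> borel_measurable ?C"
    unfolding extended_target_def [abs_def]
    by (intro borel_measurable_sum borel_measurable_times borel_measurable_prod comp meas
        borel_measurable_const) auto
  have T_nonneg: "?T xs \<ge> 0" for xs
    unfolding extended_target_def using \<pi>_nonneg q_pos
    by (intro mult_nonneg_nonneg sum_nonneg prod_nonneg) (auto intro: less_imp_le)
  \<comment> \<open>Slot \<open>i\<close> of the \<open>i\<close>-th summand carries
    \<open>f * \<pi>\<close>. All \<open>N\<close> summands have the same integral, so the average
    equals it.\<close>
  have "has_bochner_integral ?C
      (\<lambda>xs. (\<Sum>i=1..N. f (xs i) * \<pi> (xs i) * (\<Prod>j\<in>{1..N} - {i}. q (xs j))) / real N)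
      ((\<Sum>i=1..N. \<integral>x. f x * \<pi> x \<partial>lebesgue) / real N)"
    using f\<pi> probability_density_has_bochner_integral[OF assms(11)]
    by (intro has_bochner_integral_divide has_bochner_integral_sum
        has_bochner_integral_swapped_component) auto
  then have "has_bochner_integral ?C (\<lambda>xs. ?T xs * ?S xs) (\<integral>x. f x * \<pi> x \<partial>lebesgue)"
    using assms(1)
    by (simp add: extended_target_mult_self_normalized_estimate[OF assms(1) \<gamma>_pos q_pos assms(7)])
  moreover have "(\<integral>x. f x \<partial>law lebesgue \<pi>) = (\<integral>x. f x * \<pi> x \<partial>lebesgue)"
    unfolding law_def using \<pi>_nonneg by (subst integral_real_density) (auto simp: mult.commute)
  \<comment> \<open>Integrating against \<open>law\<close> means multiplying the integrand by the
    nonnegative density \<open>?T\<close>. The Bochner statement about \<open>?T xs * ?S xs\<close>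
    then yields both integrability and the value.\<close>
  ultimately show ?thesis
    unfolding law_def
    by (simp add: integral_real_density[OF T_meas _ S_meas] integrable_real_density[OF T_meas _ S_meas]
        T_nonneg has_bochner_integral_iff)
qed

end
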